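(* The tetrablock $\mathbb{E}$ is inhomogeneous; that is, the group of automorphisms of $\mathbb{E}$ does not act transitively on $\mathbb{E}$.
   Context: The tetrablock is the domain $$\mathbb{E}=\{(x_1,x_2,x_3)\in\mathbb{C}^3: 1-x_1z-x_2w+x_3zw\neq 0 \text{ for all } z,w\in\mathbb{C} \text{ with } |z|\leq 1,\ |w|\leq 1\}.$$ An automorphism of a domain $\Omega$ is an analytic (holomorphic) bijective self-map of $\Omega$ having an analytic inverse. A domain is homogeneous if its automorphism group acts transitively on it, and inhomogeneous otherwise. *)

theory Defs
  imports "HOL-Analysis.Analysis"
begin

text \<open>
  Holomorphy in several complex variables as complex Frechet differentiability. The library's
  \<^const>\<open>has_derivative\<close> only provides a real-linear derivative, so complex linearity (with respect
  to componentwise scalar multiplication) is required separately.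
  The notion is meant for open \<open>S\<close>, where \<open>at x within S\<close> is \<open>at x\<close>.
\<close>

definition holomorphic_map_on :: "(complex^'n \<Rightarrow> complex^'m) \<Rightarrow> (complex^'n) set \<Rightarrow> bool" where
  "holomorphic_map_on f S \<longleftrightarrow>
     (\<forall>x\<in>S. \<exists>f'. (f has_derivative f') (at x within S) \<and> Vector_Spaces.linear (*s) (*s) f')"

text \<open>
  Automorphisms are total functions whose values off \<open>\<Omega>\<close> are irrelevant: on \<open>\<Omega>\<close> each condition below
  depends only on the restriction of \<open>f\<close> to \<open>\<Omega>\<close>.
\<close>

definition automorphisms :: "(complex^'n) set \<Rightarrow> (complex^'n \<Rightarrow> complex^'n) set" where
  "automorphisms \<Omega> =
     {f. bij_betw f \<Omega> \<Omega> \<and> holomorphic_map_on f \<Omega> \<and> holomorphic_map_on (inv_into \<Omega> f) \<Omega>}"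

definition homogeneous :: "(complex^'n) set \<Rightarrow> bool" where
  "homogeneous \<Omega> \<longleftrightarrow> (\<forall>x\<in>\<Omega>. \<forall>y\<in>\<Omega>. \<exists>f\<in>automorphisms \<Omega>. f x = y)"

definition tetrablock :: "(complex^3) set" where
  "tetrablock =
     {x. \<forall>z w. norm z \<le> 1 \<longrightarrow> norm w \<le> 1 \<longrightarrow> 1 - x $ 1 * z - x $ 2 * w + x $ 3 * z * w \<noteq> 0}"

end

theory Submission
  imports Defs "HOL-Complex_Analysis.Riemann_Mapping"
begin

text \<open>
  No automorphism \<open>f\<close> of the tetrablock maps the origin to \<open>p = (0, 0, t)\<close> with \<open>0 < t < 1\<close>. The reason
  is infinitesimal: at each point \<open>x\<close> consider the set of gradients of holomorphic functions from the
  tetrablock to the unit disc that vanish at \<open>x\<close>, which is the dual unit ball of the Caratheodory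
  metric. The derivative of \<open>f\<close> at the origin would identify the sets at the origin and at \<open>p\<close> by a
  complex linear isomorphism, but they are not linearly equivalent.

  Both sets are estimated from inside by the functions \<open>\<Psi>\<close>, which are disc-valued directly by the
  definition of the tetrablock, and from outside by the Schwarz-Pick lemma along explicit analytic
  discs. At the origin the set is \<open>{\<eta>. \<bar>\<eta>\<^sub>1\<bar> + \<bar>\<eta>\<^sub>2\<bar> \<le> 1, \<bar>\<eta>\<^sub>3\<bar> \<le> 1}\<close>, with extreme points
  \<open>(\<alpha>, 0, \<beta>)\<close> and \<open>(0, \<alpha>, \<beta>)\<close> for unimodular \<open>\<alpha>\<close> and \<open>\<beta>\<close> (\<open>tetrablock_gradient_bound_at_zero\<close>). At
  \<open>p\<close>, after scaling by \<open>1 - t\<^sup>2\<close>, the set contains \<open>(z, - t cnj z, 1)\<close> and \<open>(- t cnj z, z, 1)\<close> for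
  unimodular \<open>z\<close>, satisfies \<open>\<bar>\<xi>\<^sub>3\<bar> \<le> 1\<close>, and satisfies \<open>\<bar>\<xi>\<^sub>1\<bar> \<le> 1\<close> on its face \<open>\<xi>\<^sub>3 = 1\<close>
  (\<open>tetrablock_gradient_bound_at_axis_point\<close>).

  A linear isomorphism must map the face \<open>\<xi>\<^sub>3 = 1\<close>, whose real dimension is 4, to a face of the set at
  the origin. The only faces of that dimension are the copies \<open>\<eta>\<^sub>3 = const\<close> of the unit ball of the
  \<open>l\<^sup>1\<close> norm, since all other faces lie in a lower-dimensional real space. The functional \<open>\<xi>\<^sub>1\<close> is bounded
  by \<open>1\<close> on this face, so the preimage of a value \<open>\<xi>\<^sub>1 = z\<close> with \<open>\<bar>z\<bar> = 1\<close> is at most a segment of the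
  \<open>l\<^sup>1\<close> ball, on whose points the arguments of both coordinates are prescribed. Both coordinates are
  complex affine in \<open>(\<xi>\<^sub>1, \<xi>\<^sub>2)\<close>, and a contribution of \<open>\<xi>\<^sub>2 = - t cnj z\<close> would turn against \<open>z\<close> and spoil
  these arguments. Hence the coordinates do not depend on \<open>\<xi>\<^sub>2\<close>, and the map is not injective. For
  \<open>t = 0\<close> there is no such contribution and no contradiction. The argument is carried out in
  \<open>no_linear_matching_of_gradients\<close>.
\<close>

(* Frees the dollar sign for vector components. *)
unbundle no fps_syntax

section \<open>Schwarz-Pick estimates along analytic discs\<close>

text \<open>
  The unimodular factor that turns \<open>b\<close> into the direction of \<open>a\<close> gives equality in the triangle
  inequality. A family of bounds that is invariant under rotating one summand thus bounds a sum of
  absolute values; all sums of norms below arise in this way.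
\<close>
lemma norm_add_norm_le_if_unimodular_bound:
  fixes a b :: complex
  assumes "\<And>\<beta>. norm \<beta> = 1 \<Longrightarrow> norm (a + b * \<beta>) \<le> c"
  shows "norm a + norm b \<le> c"
proof (cases "a = 0 \<or> b = 0")
  case True
  then show ?thesis using assms[of 1] by auto
next
  case False
  define \<beta> where "\<beta> = (a / norm a) * (norm b / b)"
  have "norm \<beta> = 1" using False by (simp add: \<beta>_def norm_mult norm_divide)
  moreover have "a + b * \<beta> = (a / norm a) * of_real (norm a + norm b)"
    using False by (simp add: \<beta>_def field_simps)
  then have "norm (a + b * \<beta>) = norm a + norm b"
    using False by (simp only: norm_mult norm_divide norm_of_real) simp
  ultimately show ?thesis using assms[of \<beta>] by simp
qed

text \<open>
  Reduction to the Schwarz lemma: the Moebius map that moves \<open>h 0\<close> to \<open>0\<close> has derivative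
  \<open>1 / (1 - \<bar>h 0\<bar>\<^sup>2)\<close> at \<open>h 0\<close>.
\<close>
lemma Schwarz_Pick_at_zero:
  assumes h: "h holomorphic_on ball 0 1" and h1: "\<And>z. norm z < 1 \<Longrightarrow> norm (h z) < 1"
    and D: "(h has_field_derivative D) (at 0)"
  shows "norm D \<le> 1 - (norm (h 0))\<^sup>2"
proof -
  define k where "k = Moebius_function 0 (h 0) \<circ> h"
  have a: "norm (h 0) < 1" by (rule h1) simp
  have khol: "k holomorphic_on ball 0 1"
    unfolding k_def using h1
    by (intro holomorphic_on_compose_gen[OF h Moebius_function_holomorphic[OF a]]) auto
  have k1: "norm (k z) < 1" if "norm z < 1" for z
    unfolding k_def using Moebius_function_norm_lt_1[OF a h1[OF that]] by simp
  have sq: "cnj (h 0) * h 0 = of_real ((norm (h 0))\<^sup>2)"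
    using complex_norm_square[of "h 0"] by (simp add: mult.commute)
  have pos: "0 < 1 - (norm (h 0))\<^sup>2" using a by (simp add: abs_square_less_1)
  have r: "1 - cnj (h 0) * h 0 = of_real (1 - (norm (h 0))\<^sup>2)" unfolding sq by simp
  have nz: "1 - cnj (h 0) * h 0 \<noteq> 0" unfolding r of_real_eq_0_iff using pos by simp
  have "(k has_field_derivative D / (1 - cnj (h 0) * h 0)) (at 0)"
  proof -
    define q where "q = 1 - cnj (h 0) * h 0"
    have "(k has_field_derivative (D * q - (h 0 - h 0) * (- (cnj (h 0) * D))) / (q * q)) (at 0)"
      unfolding k_def comp_def Moebius_function_simple q_def using nz D
      by (auto intro!: derivative_eq_intros)
    then show ?thesis using nz by (simp flip: q_def)
  qed
  then have "deriv k 0 = D / of_real (1 - (norm (h 0))\<^sup>2)" unfolding r by (rule DERIV_imp_deriv)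
  moreover have "norm (deriv k 0) \<le> 1"
    by (rule Schwarz_Lemma(2)[OF khol _ k1, of 0]) (simp_all add: k_def Moebius_function_eq_zero)
  ultimately show ?thesis using pos by (simp add: norm_divide del: of_real_diff of_real_power)
qed

text \<open>
  A gradient is a complex row vector, so that complex linearity of the derivative is part of the
  notion.
\<close>
definition has_gradient :: "(complex^'n \<Rightarrow> complex) \<Rightarrow> complex^'n \<Rightarrow> complex^'n \<Rightarrow> (complex^'n) set \<Rightarrow> bool" where
  "has_gradient g a x S \<longleftrightarrow> (g has_derivative (\<lambda>v. \<Sum>i\<in>UNIV. a$i * v$i)) (at x within S)"

lemma has_derivative_vec_of_components:
  fixes \<phi> :: "complex \<Rightarrow> complex^'n"
  assumes "\<And>i. ((\<lambda>z. \<phi> z $ i) has_field_derivative d$i) (at z)"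
  shows "(\<phi> has_derivative (\<lambda>h. h *s d)) (at z)"
proof -
  have "((\<lambda>z. \<phi> z \<bullet> b) has_derivative (\<lambda>h. (h *s d) \<bullet> b)) (at z)" if "b \<in> Basis" for b
  proof -
    from that obtain i u where b: "b = axis i u" by (auto simp: Basis_vec_def)
    have "((\<lambda>z. \<phi> z $ i) has_derivative (\<lambda>h. h * d$i)) (at z)"
      by (rule has_derivative_eq_rhs[OF assms[of i, unfolded has_field_derivative_def]])
        (simp add: fun_eq_iff mult.commute)
    then show ?thesis unfolding b inner_axis
      by (auto intro!: has_derivative_inner_left)
  qed
  then show ?thesis using has_derivative_componentwise_within[of \<phi> _ z UNIV] by auto
qed

text \<open>
  The tool for all metric estimates: an analytic disc through \<open>x\<close> in direction \<open>d\<close> bounds the value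
  at \<open>d\<close> of the gradient of every disc-valued function on \<open>S\<close>. In other words, the Caratheodory metric
  is at most the Kobayashi metric.
\<close>
lemma Schwarz_Pick_along_disc:
  fixes g :: "complex^'n \<Rightarrow> complex" and \<phi> :: "complex \<Rightarrow> complex^'n" and d a x :: "complex^'n"
  assumes g: "\<And>x. x \<in> S \<Longrightarrow> norm (g x) < 1" "\<And>x. x \<in> S \<Longrightarrow> \<exists>a. has_gradient g a x S"
    and \<phi>S: "\<And>z. norm z < 1 \<Longrightarrow> \<phi> z \<in> S"
    and \<phi>: "\<And>z i. norm z < 1 \<Longrightarrow> \<exists>c. ((\<lambda>z. \<phi> z $ i) has_field_derivative c) (at z)"
    and d: "\<And>i. ((\<lambda>z. \<phi> z $ i) has_field_derivative d$i) (at 0)"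
    and a: "has_gradient g a x S" and x: "\<phi> 0 = x"
  shows "norm (\<Sum>i\<in>UNIV. a$i * d$i) \<le> 1 - (norm (g x))\<^sup>2"
proof -
  have chain: "((\<lambda>z. g (\<phi> z)) has_field_derivative (\<Sum>i\<in>UNIV. b$i * c$i)) (at z)"
    if "norm z < 1" "has_gradient g b (\<phi> z) S"
       "\<And>i. ((\<lambda>z. \<phi> z $ i) has_field_derivative c$i) (at z)" for z b c
  proof -
    have "(\<phi> has_derivative (\<lambda>h. h *s c)) (at z within ball 0 1)"
      using has_derivative_vec_of_components[OF that(3)] has_derivative_at_withinI by blast
    moreover have "(g has_derivative (\<lambda>v. \<Sum>i\<in>UNIV. b$i * v$i)) (at (\<phi> z) within \<phi> ` ball 0 1)"
      using that(2) \<phi>S unfolding has_gradient_def by (auto intro: has_derivative_subset)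
    ultimately have "(g \<circ> \<phi> has_derivative (\<lambda>v. \<Sum>i\<in>UNIV. b$i * v$i) \<circ> (\<lambda>h. h *s c)) (at z within ball 0 1)"
      by (rule diff_chain_within)
    moreover have "at z within ball 0 1 = at z" using that(1) by (intro at_within_open) auto
    moreover have "(\<Sum>i\<in>UNIV. b$i * (h *s c)$i) = (\<Sum>i\<in>UNIV. b$i * c$i) * h" for h
      unfolding sum_distrib_right by (intro sum.cong) (simp_all add: ac_simps)
    ultimately show ?thesis by (simp add: has_field_derivative_def comp_def)
  qed
  have "norm (\<Sum>i\<in>UNIV. a$i * d$i) \<le> 1 - (norm ((\<lambda>z. g (\<phi> z)) 0))\<^sup>2"
  proof (rule Schwarz_Pick_at_zero)
    show "(\<lambda>z. g (\<phi> z)) holomorphic_on ball 0 1"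
    proof (rule holomorphic_onI)
      fix z :: complex assume "z \<in> ball 0 1"
      then have z: "norm z < 1" by simp
      obtain b where b: "has_gradient g b (\<phi> z) S" using g(2) \<phi>S z by blast
      obtain c where "\<And>i. ((\<lambda>z. \<phi> z $ i) has_field_derivative c i) (at z)"
        using \<phi>[OF z] by metis
      then have "((\<lambda>z. g (\<phi> z)) has_field_derivative (\<Sum>i\<in>UNIV. b$i * (\<chi> i. c i)$i)) (at z)"
        by (intro chain[OF z b]) simp
      then show "(\<lambda>z. g (\<phi> z)) field_differentiable at z within ball 0 1"
        using field_differentiable_at_within field_differentiable_def by blast
    qed
    show "((\<lambda>z. g (\<phi> z)) has_field_derivative (\<Sum>i\<in>UNIV. a$i * d$i)) (at 0)"
      by (rule chain) (use a x d in auto)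
  qed (use g \<phi>S in auto)
  then show ?thesis by (simp add: x)
qed

lemma has_gradient_compose:
  fixes f :: "complex^'n \<Rightarrow> complex^'m" and A :: "complex^'n^'m"
  assumes f: "(f has_derivative (*v) A) (at x within S)" and fS: "f ` S \<subseteq> T"
    and g: "has_gradient g a (f x) T"
  shows "has_gradient (\<lambda>x. g (f x)) (transpose A *v a) x S"
proof -
  have "(g has_derivative (\<lambda>v. \<Sum>i\<in>UNIV. a$i * v$i)) (at (f x) within f ` S)"
    using g fS unfolding has_gradient_def by (blast intro: has_derivative_subset)
  from diff_chain_within[OF f this]
  have "(g \<circ> f has_derivative (\<lambda>v. \<Sum>i\<in>UNIV. a$i * v$i) \<circ> (*v) A) (at x within S)" .
  moreover have "(\<Sum>i\<in>UNIV. a$i * (A *v v)$i) = (\<Sum>j\<in>UNIV. (transpose A *v a)$j * v$j)" for v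
    unfolding matrix_vector_mult_def transpose_def
    by (simp add: sum_distrib_left sum_distrib_right, subst sum.swap)
      (auto intro!: sum.cong simp: ac_simps)
  ultimately show ?thesis by (simp add: has_gradient_def comp_def)
qed

section \<open>Disc-valued functions on the tetrablock\<close>

text \<open>
  For unimodular \<open>\<omega>\<close> the condition that defines the tetrablock, read at \<open>w = \<omega>\<close>, says that an affine
  polynomial in \<open>z\<close> has no root in the closed unit disc. The reciprocal of its root is \<open>\<Psi> 1 2 \<omega>\<close>, which
  therefore maps the tetrablock to the open unit disc. The two index pairs
  \<open>(1, 2)\<close> and \<open>(2, 1)\<close> correspond to the symmetry of the tetrablock that swaps \<open>x\<^sub>1\<close> and \<open>x\<^sub>2\<close>.
\<close>
definition \<Psi> :: "3 \<Rightarrow> 3 \<Rightarrow> complex \<Rightarrow> complex^3 \<Rightarrow> complex" where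
  "\<Psi> i j \<omega> x = (x$i - \<omega> * x$3) / (1 - \<omega> * x$j)"

lemma \<Psi>_on_tetrablock:
  fixes x :: "complex^3"
  assumes x: "x \<in> tetrablock" and ij: "i = 1 \<and> j = 2 \<or> i = 2 \<and> j = 1" and \<omega>: "norm \<omega> = 1"
  shows "1 - \<omega> * x$j \<noteq> 0" and "norm (\<Psi> i j \<omega> x) < 1"
proof -
  have *: "1 - x$i * z - x$j * \<omega> + x$3 * z * \<omega> \<noteq> 0" if "norm z \<le> 1" for z
    using ij
  proof
    assume "i = 1 \<and> j = 2" then show ?thesis
      using x that \<omega> unfolding tetrablock_def by auto
  next
    assume ij: "i = 2 \<and> j = 1"
    have "1 - x$1 * \<omega> - x$2 * z + x$3 * \<omega> * z \<noteq> 0"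
      using x that \<omega> unfolding tetrablock_def by auto
    then show ?thesis using ij by (simp add: algebra_simps)
  qed
  show nz: "1 - \<omega> * x$j \<noteq> 0" using *[of 0] by (simp add: mult.commute)
  show "norm (\<Psi> i j \<omega> x) < 1"
  proof (rule ccontr)
    assume "\<not> norm (\<Psi> i j \<omega> x) < 1"
    then have ge: "1 \<le> norm (\<Psi> i j \<omega> x)" by simp
    then have "x$i - \<omega> * x$3 \<noteq> 0" by (auto simp: \<Psi>_def)
    then have "1 - x$i * (1 / \<Psi> i j \<omega> x) - x$j * \<omega> + x$3 * (1 / \<Psi> i j \<omega> x) * \<omega> = 0"
      using nz unfolding \<Psi>_def by (simp add: field_simps)
    moreover have "norm (1 / \<Psi> i j \<omega> x) \<le> 1" using ge by (simp add: norm_divide divide_le_eq)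
    ultimately show False using * by blast
  qed
qed

lemma has_gradient_\<Psi>:
  fixes x :: "complex^3"
  assumes nz: "1 - \<omega> * x$j \<noteq> 0" and ij: "i = 1 \<and> j = 2 \<or> i = 2 \<and> j = 1"
  shows "has_gradient (\<Psi> i j \<omega>)
           (\<chi> k. if k = i then 1 / (1 - \<omega> * x$j)
                 else if k = j then \<omega> * (x$i - \<omega> * x$3) / (1 - \<omega> * x$j)\<^sup>2
                 else - \<omega> / (1 - \<omega> * x$j)) x S"
proof -
  have nth: "((\<lambda>x::complex^3. x$k) has_derivative (\<lambda>v. v$k)) (at x within S)" for k
    by (rule bounded_linear.has_derivative[OF bounded_linear_vec_nth has_derivative_ident])
  have "(\<Psi> i j \<omega> has_derivative (\<lambda>v. ((v$i - \<omega> * v$3) * (1 - \<omega> * x$j)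
             - (x$i - \<omega> * x$3) * (- \<omega> * v$j)) / ((1 - \<omega> * x$j) * (1 - \<omega> * x$j)))) (at x within S)"
    unfolding \<Psi>_def using nz
    by (auto intro!: derivative_eq_intros nth)
  moreover have "((v$i - \<omega> * v$3) * D - (x$i - \<omega> * x$3) * (- \<omega> * v$j)) / (D * D)
      = (\<Sum>k\<in>UNIV. (\<chi> k. if k = i then 1 / D
                 else if k = j then \<omega> * (x$i - \<omega> * x$3) / D\<^sup>2 else - \<omega> / D)$k * v$k)"
    if "D \<noteq> 0" for v D
    using ij that by (auto simp: sum_3 field_simps power2_eq_square)
  ultimately show ?thesis unfolding has_gradient_def using nz by simp
qed

section \<open>Gradient bounds from analytic discs in the tetrablock\<close>

lemma slice_in_tetrablock:
  fixes x :: "complex^3"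
  assumes "x$2 = 0" "norm (x$1) + norm (x$3) < 1"
  shows "x \<in> tetrablock"
proof -
  have "1 - x$1 * z - x$2 * w + x$3 * z * w \<noteq> 0" if "norm z \<le> 1" "norm w \<le> 1" for z w
  proof
    assume "1 - x$1 * z - x$2 * w + x$3 * z * w = 0"
    then have "1 = (x$1 - x$3 * w) * z" using assms(1) by (simp add: algebra_simps)
    then have "1 = norm (x$1 - x$3 * w) * norm z" by (metis norm_mult norm_one)
    also have "\<dots> \<le> norm (x$1 - x$3 * w)" using that by (simp add: mult_left_le)
    also have "\<dots> \<le> norm (x$1) + norm (x$3 * w)" by (rule norm_triangle_ineq4)
    also have "\<dots> \<le> norm (x$1) + norm (x$3)" using that by (simp add: norm_mult mult_left_le)
    finally show False using assms(2) by simp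
  qed
  then show ?thesis by (simp add: tetrablock_def)
qed

text \<open>
  On the royal variety \<open>x\<^sub>3 = x\<^sub>1 x\<^sub>2\<close> the defining polynomial factors into \<open>(1 - a z) (1 - b w)\<close>.
\<close>
lemma royal_in_tetrablock:
  assumes "norm a < 1" "norm b < 1"
  shows "vector [a, b, a * b] \<in> tetrablock"
proof -
  have ne: "c * z \<noteq> 1" if "norm c < 1" "norm z \<le> 1" for c z :: complex
  proof
    assume "c * z = 1"
    then have "1 = norm c * norm z" by (metis norm_mult norm_one)
    also have "\<dots> \<le> norm c" using that by (simp add: mult_left_le)
    finally show False using that by simp
  qed
  have "1 - a * z - b * w + a * b * z * w \<noteq> 0" if "norm z \<le> 1" "norm w \<le> 1" for z w
  proof -
    have "1 - a * z - b * w + a * b * z * w = (1 - a * z) * (1 - b * w)" by (simp add: algebra_simps)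
    then show ?thesis using ne[OF assms(1) that(1)] ne[OF assms(2) that(2)] by simp
  qed
  then show ?thesis by (simp add: tetrablock_def)
qed

lemma ball_subset_tetrablock: "ball 0 (1/3) \<subseteq> tetrablock"
proof
  fix x :: "complex^3" assume "x \<in> ball 0 (1/3)"
  then have x: "norm (x$i) < 1/3" for i
    using Finite_Cartesian_Product.norm_nth_le[of x i] by simp
  have "1 - x$1 * z - x$2 * w + x$3 * z * w \<noteq> 0" if zw: "norm z \<le> 1" "norm w \<le> 1" for z w
  proof
    assume "1 - x$1 * z - x$2 * w + x$3 * z * w = 0"
    then have "1 = x$1 * z + x$2 * w - x$3 * (z * w)" by (simp add: algebra_simps)
    then have "1 = norm (x$1 * z + x$2 * w - x$3 * (z * w))" by (metis norm_one)
    also have "\<dots> \<le> norm (x$1 * z) + norm (x$2 * w) + norm (x$3 * (z * w))"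
      by (meson add_mono norm_triangle_ineq norm_triangle_ineq4 order_refl order_trans)
    also have "\<dots> \<le> norm (x$1) + norm (x$2) + norm (x$3)"
      using zw by (intro add_mono) (auto simp: norm_mult mult_left_le mult_le_one)
    finally show False using x[of 1] x[of 2] x[of 3] by simp
  qed
  then show "x \<in> tetrablock" by (simp add: tetrablock_def)
qed

text \<open>
  The discs \<open>z \<mapsto> (z, \<beta> z, \<beta> z\<^sup>2)\<close> in the royal variety and \<open>z \<mapsto> (0, 0, z)\<close>. They suffice: the
  unimodular multiples of the gradients of the functions \<open>\<Psi>\<close> at the origin are the extreme points of
  the product of the unit ball of the \<open>l\<^sup>1\<close> norm in two variables and a disc, so no better bound holds.
\<close>
lemma tetrablock_gradient_bound_at_zero:
  assumes g: "\<And>x. x \<in> tetrablock \<Longrightarrow> norm (g x) < 1"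
      "\<And>x. x \<in> tetrablock \<Longrightarrow> \<exists>a. has_gradient g a x tetrablock"
    and a: "has_gradient g a 0 tetrablock"
  shows "norm (a$1) + norm (a$2) \<le> 1 - (norm (g 0))\<^sup>2"
    and "norm (a$3) \<le> 1 - (norm (g 0))\<^sup>2"
proof -
  show "norm (a$1) + norm (a$2) \<le> 1 - (norm (g 0))\<^sup>2"
  proof (rule norm_add_norm_le_if_unimodular_bound)
    fix \<beta> :: complex assume \<beta>: "norm \<beta> = 1"
    define \<phi> where "\<phi> z = (vector [z, \<beta> * z, z * (\<beta> * z)] :: complex^3)" for z
    define d where "d z = (vector [1, \<beta>, 2 * \<beta> * z] :: complex^3)" for z
    have D: "((\<lambda>z. \<phi> z $ i) has_field_derivative d z $ i) (at z)" for i z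
      using exhaust_3[of i] by (auto simp: \<phi>_def d_def intro!: derivative_eq_intros)
    have "norm (\<Sum>i\<in>UNIV. a$i * d 0$i) \<le> 1 - (norm (g 0))\<^sup>2"
    proof (rule Schwarz_Pick_along_disc[OF g])
      show "\<phi> z \<in> tetrablock" if "norm z < 1" for z
        unfolding \<phi>_def using that \<beta> by (intro royal_in_tetrablock) (auto simp: norm_mult)
      show "\<phi> 0 = 0" by (simp add: \<phi>_def vec_eq_iff forall_3)
    qed (use D a in auto)
    then show "norm (a$1 + a$2 * \<beta>) \<le> 1 - (norm (g 0))\<^sup>2" by (simp add: sum_3 d_def)
  qed
  define \<phi> where "\<phi> z = (vector [0, 0, z] :: complex^3)" for z
  define d where "d = (vector [0, 0, 1] :: complex^3)"
  have D: "((\<lambda>z. \<phi> z $ i) has_field_derivative d $ i) (at z)" for i z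
    using exhaust_3[of i] by (auto simp: \<phi>_def d_def intro!: derivative_eq_intros)
  have "norm (\<Sum>i\<in>UNIV. a$i * d$i) \<le> 1 - (norm (g 0))\<^sup>2"
  proof (rule Schwarz_Pick_along_disc[OF g])
    show "\<phi> z \<in> tetrablock" if "norm z < 1" for z
      unfolding \<phi>_def using that by (intro slice_in_tetrablock) auto
    show "\<phi> 0 = 0" by (simp add: \<phi>_def vec_eq_iff forall_3)
  qed (use D a in auto)
  then show "norm (a$3) \<le> 1 - (norm (g 0))\<^sup>2" by (simp add: sum_3 d_def)
qed

text \<open>
  In the slice \<open>x\<^sub>2 = 0\<close>, the disc below is the Moebius disc \<open>z \<mapsto> (r z + t) / (1 + t r z)\<close> in the third
  coordinate, shrunk by \<open>r\<close> to leave room for a first coordinate of size \<open>1 - r\<^sup>2\<close>. The square in the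
  denominator of the first coordinate is the one in the identity
  \<open>\<bar>1 + t w\<bar>\<^sup>2 - \<bar>w + t\<bar>\<^sup>2 = (1 - t\<^sup>2) (1 - \<bar>w\<bar>\<^sup>2)\<close>, and this makes the disc optimal to first order
  as \<open>r\<close> tends to \<open>1\<close>.
\<close>
lemma gradient_bound_along_slice_disc:
  fixes t r :: real
  assumes t: "0 < t" "t < 1" and r: "0 < r" "r \<le> 1"
    and g: "\<And>x. x \<in> tetrablock \<Longrightarrow> norm (g x) < 1"
      "\<And>x. x \<in> tetrablock \<Longrightarrow> \<exists>a. has_gradient g a x tetrablock"
    and a: "has_gradient g a (vector [0, 0, t]) tetrablock"
  shows "r * ((1 - t\<^sup>2) * norm (a$3)) + (1 - r\<^sup>2) / 2 * ((1 - t\<^sup>2) * norm (a$1))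
           \<le> 1 - (norm (g (vector [0, 0, t])))\<^sup>2"
proof -
  define k where "k = (1 - t\<^sup>2) * (1 - r\<^sup>2) / 2"
  have t2: "0 < 1 - t\<^sup>2" using t by (simp add: abs_square_less_1)
  have r2: "0 \<le> 1 - r\<^sup>2" using r by (simp add: abs_square_le_1)
  have k0: "0 \<le> k" using t2 r2 by (simp add: k_def)
  have "norm (a$3 * (r * (1 - t\<^sup>2))) + norm (a$1 * k) \<le> 1 - (norm (g (vector [0, 0, t])))\<^sup>2"
  proof (rule norm_add_norm_le_if_unimodular_bound)
    fix \<beta> :: complex assume \<beta>: "norm \<beta> = 1"
    define \<phi> where "\<phi> z = (vector [k * \<beta> * z / (1 + t * (r * z))\<^sup>2, 0,
                              (r * z + t) / (1 + t * (r * z))] :: complex^3)" for z :: complex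
    define d where "d = (vector [k * \<beta>, 0, r * (1 - t\<^sup>2)] :: complex^3)"
    have nz: "1 + t * (r * z) \<noteq> 0" if "norm z < 1" for z :: complex
    proof
      assume "1 + t * (r * z) = 0"
      then have "t * (r * z) = - 1" by (simp add: eq_neg_iff_add_eq_0 add.commute)
      then have "norm (t * (r * z)) = 1" by simp
      then have "t * (r * norm z) = 1" using t r by (simp add: norm_mult)
      moreover have "t * (r * norm z) \<le> t" using t r that by (simp add: mult_le_one)
      ultimately show False using t by simp
    qed
    have D: "\<exists>c. ((\<lambda>z. \<phi> z $ i) has_field_derivative c) (at z)" if "norm z < 1" for i z
      using exhaust_3[of i] nz[OF that] unfolding field_differentiable_def[symmetric]
      by (auto simp: \<phi>_def intro!: derivative_intros)
    have D0: "((\<lambda>z. \<phi> z $ i) has_field_derivative d $ i) (at 0)" for i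
      using exhaust_3[of i]
      by (auto simp: \<phi>_def d_def power2_eq_square algebra_simps intro!: derivative_eq_intros)
    have "norm (\<Sum>i\<in>UNIV. a$i * d$i) \<le> 1 - (norm (g (vector [0, 0, t])))\<^sup>2"
    proof (rule Schwarz_Pick_along_disc[OF g])
      fix z :: complex assume z: "norm z < 1"
      define w where "w = r * z"
      define n where "n = norm (1 + t * w)"
      have n: "0 < n" using nz[OF z] by (simp add: n_def w_def)
      have x1: "norm (\<phi> z $ 1) = k * norm z / n\<^sup>2"
        using k0 \<beta> by (simp add: \<phi>_def n_def w_def norm_divide norm_mult norm_power)
      have x3: "norm (\<phi> z $ 3) = norm (w + t) / n"
        by (simp add: \<phi>_def n_def w_def norm_divide)
      have id: "n\<^sup>2 - (norm (w + t))\<^sup>2 = (1 - t\<^sup>2) * (1 - (norm w)\<^sup>2)"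
        unfolding n_def cmod_power2 by (simp add: algebra_simps power2_eq_square)
      have w: "(norm w)\<^sup>2 = r\<^sup>2 * (norm z)\<^sup>2" using r by (simp add: w_def norm_mult power_mult_distrib)
      \<comment> \<open>Membership in the slice needs \<open>\<bar>x\<^sub>1\<bar> < 1 - \<bar>x\<^sub>3\<bar>\<close>, which follows from
        \<open>2 \<bar>x\<^sub>1\<bar> < 1 - \<bar>x\<^sub>3\<bar>\<^sup>2\<close>.\<close>
      have "(norm z)\<^sup>2 \<le> norm z" using z by (simp add: power2_eq_square mult_left_le)
      then have "r\<^sup>2 * (norm z)\<^sup>2 \<le> r\<^sup>2 * norm z" by (intro mult_left_mono) auto
      then have "(1 - r\<^sup>2) * norm z < 1 - (norm w)\<^sup>2" using z unfolding w by (simp add: algebra_simps)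
      then have "2 * (k * norm z) < n\<^sup>2 - (norm (w + t))\<^sup>2"
        unfolding id k_def using t2 by (simp add: mult.assoc)
      then have "2 * (k * norm z) / n\<^sup>2 < (n\<^sup>2 - (norm (w + t))\<^sup>2) / n\<^sup>2"
        using n by (intro divide_strict_right_mono) auto
      then have "2 * norm (\<phi> z $ 1) < 1 - (norm (\<phi> z $ 3))\<^sup>2"
        unfolding x1 x3 using n by (simp add: diff_divide_distrib power_divide)
      also have "\<dots> \<le> 2 * (1 - norm (\<phi> z $ 3))"
        using zero_le_power2[of "1 - norm (\<phi> z $ 3)"] by (simp add: power2_eq_square algebra_simps)
      finally show "\<phi> z \<in> tetrablock"
        by (intro slice_in_tetrablock) (auto simp: \<phi>_def)
    qed (use D D0 a in \<open>auto simp: \<phi>_def\<close>)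
    then show "norm (a$3 * (r * (1 - t\<^sup>2)) + a$1 * k * \<beta>) \<le> 1 - (norm (g (vector [0, 0, t])))\<^sup>2"
      by (simp add: sum_3 d_def algebra_simps)
  qed
  moreover have "norm (a$3 * (r * (1 - t\<^sup>2))) = r * ((1 - t\<^sup>2) * norm (a$3))"
  proof -
    have "a$3 * (r * (1 - t\<^sup>2)) = a$3 * of_real (r * (1 - t\<^sup>2))" by simp
    then show ?thesis using r t2 by (simp only: norm_mult norm_of_real) simp
  qed
  moreover have "norm (a$1 * k) = (1 - r\<^sup>2) / 2 * ((1 - t\<^sup>2) * norm (a$1))"
  proof -
    have "norm (a$1 * k) = k * norm (a$1)" using k0 by (simp add: norm_mult)
    then show ?thesis by (simp add: k_def)
  qed
  ultimately show ?thesis by simp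
qed

text \<open>
  The case \<open>r = 1\<close> bounds the third component. If this bound is attained, then dividing the
  remaining inequality by \<open>1 - r\<close> and letting \<open>r\<close> tend to \<open>1\<close> bounds the first component. The
  direction of the discs tends to that of the third axis, so this limit says nothing
  about gradients for which the first bound is strict.
\<close>
lemma tetrablock_gradient_bound_at_axis_point:
  fixes t :: real
  assumes t: "0 < t" "t < 1"
    and g: "\<And>x. x \<in> tetrablock \<Longrightarrow> norm (g x) < 1"
      "\<And>x. x \<in> tetrablock \<Longrightarrow> \<exists>a. has_gradient g a x tetrablock"
    and a: "has_gradient g a (vector [0, 0, t]) tetrablock"
    and n: "n = 1 - (norm (g (vector [0, 0, t])))\<^sup>2"
  shows "(1 - t\<^sup>2) * norm (a$3) \<le> n"
    and "(1 - t\<^sup>2) * norm (a$3) = n \<Longrightarrow> (1 - t\<^sup>2) * norm (a$1) \<le> n"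
proof -
  have *: "r * ((1 - t\<^sup>2) * norm (a$3)) + (1 - r\<^sup>2) / 2 * ((1 - t\<^sup>2) * norm (a$1)) \<le> n"
    if "0 < r" "r \<le> 1" for r
    using gradient_bound_along_slice_disc[OF t that g a] unfolding n by simp
  show "(1 - t\<^sup>2) * norm (a$3) \<le> n" using *[of 1] by simp
  assume eq: "(1 - t\<^sup>2) * norm (a$3) = n"
  define A where "A = (1 - t\<^sup>2) * norm (a$1)"
  have "(vector [0, 0, t] :: complex^3) \<in> tetrablock" using t by (intro slice_in_tetrablock) auto
  from g(1)[OF this] have n0: "0 < n" unfolding n by (simp add: abs_square_less_1)
  have "A \<le> n"
  proof (rule ccontr)
    assume "\<not> A \<le> n"
    then have An: "n < A" by simp
    \<comment> \<open>Were \<open>A > n\<close>, this \<open>r\<close> would already violate the inequality \<open>(1 + r) A \<le> 2 n\<close>, which becomes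
      \<open>A \<le> n\<close> in the limit \<open>r = 1\<close>.\<close>
    define r where "r = n / A"
    have r: "0 < r" "r < 1" using An n0 by (simp_all add: r_def)
    have "r * n + (1 - r * r) * A / 2 \<le> n"
      using *[of r] r unfolding eq A_def[symmetric] by (simp add: power2_eq_square)
    then have "2 * (r * n) + (1 - r * r) * A \<le> 2 * n" by simp
    then have "(1 - r) * ((1 + r) * A) \<le> (1 - r) * (2 * n)" by (simp add: algebra_simps)
    then have "(1 + r) * A \<le> 2 * n" using r by simp
    moreover have "(1 + r) * A = A + n" using An n0 by (simp add: r_def distrib_right)
    ultimately show False using An by simp
  qed
  then show "(1 - t\<^sup>2) * norm (a$1) \<le> n" by (simp add: A_def)
qed

section \<open>Linear inequivalence of the two sets of gradients\<close>

lemma Im_zero_if_sum_one: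
  fixes x y :: complex
  assumes "x + y = 1" "norm x + norm y \<le> 1"
  shows "Im x = 0"
proof -
  have "Re x + Re y = 1" using assms(1) by (metis plus_complex.sel(1) one_complex.sel(1))
  then have "norm x \<le> Re x"
    using assms(2) complex_Re_le_cmod[of y] by linarith
  then have "Re x = norm x" using complex_Re_le_cmod[of x] by linarith
  then show ?thesis using cmod_power2[of x] by simp
qed

text \<open>
  The equality case of the triangle inequality: the bounds leave no room, so every summand of
  \<open>c x + d y + w = 1\<close> is real. If \<open>c = 0\<close>, they even force \<open>x = 0\<close>; the factor \<open>1\<close> that then replaces
  \<open>c\<close> lets both cases be used as the reality of a nonzero multiple of \<open>x\<close>.
\<close>
lemma weighted_sum_one_imp_real:
  fixes c d x y w :: complex
  assumes sum: "c * x + d * y + w = 1"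
    and c: "norm c \<le> s" and d: "norm d \<le> s" and w: "norm w \<le> 1 - s"
    and xy: "norm x + norm y \<le> 1" and "0 < s"
  shows "Im ((if c = 0 then 1 else c) * x) = 0"
proof -
  have cx: "norm (c * x) \<le> s * norm x" and dy: "norm (d * y) \<le> s * norm y"
    using c d by (auto simp: norm_mult intro: mult_right_mono)
  have s: "s * norm x + s * norm y \<le> s"
    using mult_left_mono[OF xy, of s] \<open>0 < s\<close> by (simp add: distrib_left)
  have "Im (c * x) = 0"
  proof (rule Im_zero_if_sum_one)
    show "c * x + (d * y + w) = 1" using sum by (simp add: add.assoc)
    show "norm (c * x) + norm (d * y + w) \<le> 1"
      using norm_triangle_ineq[of "d * y" w] cx dy s w by linarith
  qed
  moreover have "x = 0" if "c = 0"
  proof -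
    have "1 \<le> norm (d * y) + norm w"
      using sum that norm_triangle_ineq[of "d * y" w] by simp
    then have "s \<le> s * norm y" using dy w by linarith
    then have "s * norm x \<le> 0" using s by linarith
    then show ?thesis using \<open>0 < s\<close> by (simp add: mult_le_0_iff)
  qed
  ultimately show ?thesis by auto
qed

text \<open>
  The hypotheses say that the complex affine function \<open>\<alpha> \<xi>\<^sub>1 + \<beta> \<xi>\<^sub>2 + \<gamma>\<close> is real on the two circles
  \<open>(z, - t cnj z)\<close> and \<open>(- t cnj z, z)\<close>. These circles span \<open>\<complex>\<^sup>2\<close> over the reals, because \<open>t \<noteq> 1\<close>, and
  a complex affine function that is real everywhere is constant. The points \<open>1\<close>, \<open>- 1\<close>, \<open>\<i>\<close>, \<open>- \<i>\<close>
  suffice.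
\<close>
lemma real_on_both_circles_imp_zero:
  fixes \<alpha> \<beta> \<gamma> :: complex and t :: real
  assumes t: "0 < t" "t < 1"
    and p: "\<And>z. norm z = 1 \<Longrightarrow> Im (\<alpha> * z - \<beta> * (t * cnj z) + \<gamma>) = 0"
    and q: "\<And>z. norm z = 1 \<Longrightarrow> Im (\<beta> * z - \<alpha> * (t * cnj z) + \<gamma>) = 0"
  shows "\<alpha> = 0" and "\<beta> = 0"
proof -
  note P = p[of 1] p[of "-1"] p[of \<i>] p[of "-\<i>"] and Q = q[of 1] q[of "-1"] q[of \<i>] q[of "-\<i>"]
  have e: "Im \<alpha> = t * Im \<beta>" "Re \<alpha> = - t * Re \<beta>" "Im \<beta> = t * Im \<alpha>" "Re \<beta> = - t * Re \<alpha>"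
    using P Q by (simp_all add: algebra_simps)
  have "(1 - t) * (1 + t) \<noteq> 0" using t by simp
  moreover have "(1 - t) * (1 + t) * Im \<alpha> = 0" "(1 - t) * (1 + t) * Re \<alpha> = 0"
    using e(1)[unfolded e(3)] e(2)[unfolded e(4)] by (simp_all add: algebra_simps)
  ultimately have "Im \<alpha> = 0" "Re \<alpha> = 0" by (simp_all only: mult_eq_0_iff simp_thms)
  then show "\<alpha> = 0" "\<beta> = 0" using e(3,4) by (simp_all add: complex_eq_iff)
qed

text \<open>
  A trigonometric polynomial in \<open>1\<close>, \<open>cnj z\<close>, \<open>(cnj z)\<^sup>2\<close> that is real on the unit circle is constant.
\<close>
lemma real_after_rotation_imp_zero:
  fixes \<alpha> \<beta> \<gamma> :: complex and t :: real
  assumes t: "0 < t"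
    and p: "\<And>z. norm z = 1 \<Longrightarrow> Im (cnj z * (\<alpha> * z - \<beta> * (t * cnj z) + \<gamma>)) = 0"
  shows "\<beta> = 0"
proof -
  \<comment> \<open>An eighth root of unity: here \<open>(cnj z)\<^sup>2\<close> is imaginary, so the real part of \<open>\<beta>\<close> becomes visible.\<close>
  define e where "e = Complex (sqrt 2 / 2) (sqrt 2 / 2)"
  have e: "norm e = 1" "e * cnj e = 1" "cnj e * cnj e = - \<i>"
    by (simp_all add: e_def complex_norm complex_eq_iff power_divide)
  have "Im \<alpha> = t * Im \<beta>" "Im \<alpha> = - t * Im \<beta>"
    using p[of 1] p[of "-1"] p[of \<i>] p[of "-\<i>"] by (simp_all add: algebra_simps)
  then have Im: "Im \<beta> = 0" "Im \<alpha> = 0" using t by auto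
  have "cnj z * (\<alpha> * z - \<beta> * (t * cnj z) + \<gamma>) = \<alpha> + \<i> * t * \<beta> + cnj z * \<gamma>"
    if "z * cnj z = 1" "cnj z * cnj z = - \<i>" for z
  proof -
    have "cnj z * (\<alpha> * z - \<beta> * (t * cnj z) + \<gamma>)
        = \<alpha> * (z * cnj z) - \<beta> * t * (cnj z * cnj z) + cnj z * \<gamma>"
      by (simp add: algebra_simps)
    then show ?thesis by (simp add: that)
  qed
  from this[of e] this[of "- e"]
  have "Im (\<alpha> + \<i> * t * \<beta> + cnj e * \<gamma>) = 0" "Im (\<alpha> + \<i> * t * \<beta> - cnj e * \<gamma>) = 0"
    using p[of e] p[of "- e"] e by simp_all
  moreover have "Im (x + y) + Im (x - y) = 2 * Im x" for x y by simp
  ultimately have "Im (\<alpha> + \<i> * t * \<beta>) = 0" by (metis add_0 mult_eq_0_iff zero_neq_numeral)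
  then have "Im \<alpha> + t * Re \<beta> = 0" by simp
  then show ?thesis using Im t by (simp add: complex_eq_iff)
qed

text \<open>
  Here \<open>M\<close> stands for the pull-back of gradients from \<open>(0, 0, t)\<close> to the origin, scaled by
  \<open>1 / (1 - t\<^sup>2)\<close>, and \<open>N\<close> for its inverse. The hypotheses on \<open>N\<close> are the bounds at \<open>(0, 0, t)\<close> for the
  images of the gradients of \<open>\<Psi>\<close> at the origin, and the one on \<open>M\<close> states the bounds at the
  origin for the images of the gradients of \<open>\<Psi>\<close> at \<open>(0, 0, t)\<close>.

  The vectors \<open>\<xi>\<close> in the hypothesis on \<open>M\<close> have third component \<open>1\<close>, so their images \<open>\<eta>\<close> lie on the
  hyperplane \<open>v \<bullet> \<eta> = 1\<close>, where \<open>v\<close> is the third row of \<open>N\<close>, and \<open>\<bar>v\<^sub>j\<bar> + \<bar>v\<^sub>3\<bar> \<le> 1\<close> for \<open>j = 1, 2\<close>. This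
  is a supporting hyperplane of the set of gradients at the origin. If \<open>\<bar>v\<^sub>3\<bar> < 1\<close>, it cuts out a face
  which is too small: the first two components of \<open>\<eta>\<close> are real on it up to constant factors, hence constant.
  If \<open>\<bar>v\<^sub>3\<bar> = 1\<close>, then \<open>v\<^sub>1 = v\<^sub>2 = 0\<close> and the face is the unit ball of the \<open>l\<^sup>1\<close> norm. The points of that
  ball at which \<open>\<xi>\<^sub>1\<close> takes the extreme value \<open>z\<close> form at most a segment, and reality along these
  segments makes the first two components of \<open>\<eta>\<close> independent of \<open>\<xi>\<^sub>2\<close>, which again contradicts
  invertibility.
\<close>
lemma no_linear_matching_of_gradients:
  fixes M N :: "complex^3^3" and t :: real
  assumes NM: "N ** M = mat 1" and t: "0 < t" "t < 1"
    and N3: "\<And>j \<beta>. j \<in> {1,2} \<Longrightarrow> norm \<beta> = 1 \<Longrightarrow> norm (N$3$j + N$3$3 * \<beta>) \<le> 1"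
    and N1: "\<And>j \<beta>. j \<in> {1,2} \<Longrightarrow> norm \<beta> = 1 \<Longrightarrow> norm (N$3$j + N$3$3 * \<beta>) = 1
               \<Longrightarrow> norm (N$1$j + N$1$3 * \<beta>) \<le> 1"
    and M: "\<And>z \<xi>. norm z = 1 \<Longrightarrow> \<xi> \<in> {vector [z, - (t * cnj z), 1], vector [- (t * cnj z), z, 1]}
               \<Longrightarrow> norm ((M *v \<xi>)$1) + norm ((M *v \<xi>)$2) \<le> 1 \<and> norm ((M *v \<xi>)$3) \<le> 1"
  shows False
proof -
  define l where "l z = (vector [z, - (t * cnj z), 1] :: complex^3)" for z :: complex
  define m where "m z = (vector [- (t * cnj z), z, 1] :: complex^3)" for z :: complex
  define d where "d i j = (if N$i$j = 0 then 1 else N$i$j)" for i j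
  have d: "d i j \<noteq> 0" for i j by (simp add: d_def)
  have Mv: "(M *v \<xi>)$k = M$k$1 * \<xi>$1 + M$k$2 * \<xi>$2 + M$k$3 * \<xi>$3" for k \<xi>
    by (simp add: matrix_vector_mult_def sum_3)
  have inv: "N$k$1 * (M *v \<xi>)$1 + N$k$2 * (M *v \<xi>)$2 + N$k$3 * (M *v \<xi>)$3 = \<xi>$k" for k \<xi>
  proof -
    have "N *v (M *v \<xi>) = \<xi>" by (simp add: matrix_vector_mul_assoc NM)
    then have "(N *v (M *v \<xi>))$k = \<xi>$k" by simp
    then show ?thesis by (simp add: matrix_vector_mult_def[of N] sum_3)
  qed
  have NMe: "N$i$1 * M$1$k + N$i$2 * M$2$k + N$i$3 * M$3$k = (if i = k then 1 else 0)" for i k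
  proof -
    have "(N ** M)$i$k = (if i = k then 1 else 0)" by (simp add: NM mat_def)
    then show ?thesis by (simp add: matrix_matrix_mult_def sum_3)
  qed
  have v: "norm (N$3$j) + norm (N$3$3) \<le> 1" if "j \<in> {1,2}" for j
    by (rule norm_add_norm_le_if_unimodular_bound) (rule N3[OF that])
  have v3: "norm (N$3$3) \<le> 1" using v[of 1, simplified] norm_ge_zero[of "N$3$1"] by linarith
  show False
  proof (cases "norm (N$3$3) < 1")
    case True
    have real: "Im (d 3 1 * (M *v \<xi>)$1) = 0 \<and> Im (d 3 2 * (M *v \<xi>)$2) = 0"
      if "norm z = 1" "\<xi> \<in> {l z, m z}" for z \<xi>
    proof -
      have \<xi>: "\<xi>$3 = 1" using that by (auto simp: l_def m_def)
      have b: "norm ((M *v \<xi>)$1) + norm ((M *v \<xi>)$2) \<le> 1" "norm ((M *v \<xi>)$3) \<le> 1"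
        using M[OF that(1), of \<xi>] that(2) by (auto simp: l_def m_def)
      have w: "norm (N$3$3 * (M *v \<xi>)$3) \<le> 1 - (1 - norm (N$3$3))"
        using mult_left_mono[OF b(2), of "norm (N$3$3)"] by (simp add: norm_mult)
      have v12: "norm (N$3$1) \<le> 1 - norm (N$3$3)" "norm (N$3$2) \<le> 1 - norm (N$3$3)"
        using v[of 1] v[of 2] by simp_all
      have sum: "N$3$1 * (M *v \<xi>)$1 + N$3$2 * (M *v \<xi>)$2 + N$3$3 * (M *v \<xi>)$3 = 1"
        using inv[of 3 \<xi>] \<xi> by simp
      then have sum': "N$3$2 * (M *v \<xi>)$2 + N$3$1 * (M *v \<xi>)$1 + N$3$3 * (M *v \<xi>)$3 = 1"
        by (simp only: add.commute)
      have b': "norm ((M *v \<xi>)$2) + norm ((M *v \<xi>)$1) \<le> 1"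
        using b(1) by linarith
      have pos: "0 < 1 - norm (N$3$3)" using True by simp
      show ?thesis
        unfolding d_def
        using weighted_sum_one_imp_real[OF sum v12 w b(1) pos]
              weighted_sum_one_imp_real[OF sum' v12(2) v12(1) w b' pos]
        by blast
    qed
    have "d 3 k * M$k$1 = 0 \<and> d 3 k * M$k$2 = 0" if k: "k = 1 \<or> k = 2" for k
    proof -
      have "Im (d 3 k * M$k$1 * z - d 3 k * M$k$2 * (t * cnj z) + d 3 k * M$k$3) = 0"
           "Im (d 3 k * M$k$2 * z - d 3 k * M$k$1 * (t * cnj z) + d 3 k * M$k$3) = 0"
        if "norm z = 1" for z
        using real[OF that, of "l z"] real[OF that, of "m z"] k
        by (auto simp: Mv l_def m_def algebra_simps)
      from real_on_both_circles_imp_zero[OF t this] show ?thesis by blast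
    qed
    then have "M$1$1 = 0" "M$1$2 = 0" "M$2$1 = 0" "M$2$2 = 0" using d by auto
    then show False using NMe[of 1 1] NMe[of 1 2] NMe[of 2 2] by auto
  next
    case False
    then have n33: "norm (N$3$3) = 1" using v3 by simp
    then have n3: "N$3$1 = 0" "N$3$2 = 0" using v[of 1] v[of 2] by auto
    have r1: "norm (N$1$j) + norm (N$1$3) \<le> 1" if "j \<in> {1,2}" for j
      using that by (intro norm_add_norm_le_if_unimodular_bound N1) (auto simp: n3 norm_mult n33)
    define k where "k = N$1$3 / N$3$3"
    have nz: "N$3$3 \<noteq> 0" using n33 by auto
    have nk: "norm k = norm (N$1$3)" by (simp add: k_def norm_divide n33)
    have row: "N$1$1 * (M *v l z)$1 + N$1$2 * (M *v l z)$2 + k = z" for z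
    proof -
      have l: "l z $ 1 = z" "l z $ 3 = 1" by (simp_all add: l_def)
      have "N$3$3 * (M *v l z)$3 = 1" using inv[of 3 "l z"] by (simp add: n3 l)
      then have "(M *v l z)$3 = 1 / N$3$3" using nz by (simp add: field_simps)
      then show ?thesis using inv[of 1 "l z"] by (simp add: k_def l)
    qed
    have b: "norm ((M *v l z)$1) + norm ((M *v l z)$2) \<le> 1" if "norm z = 1" for z
      using M[OF that, of "l z"] by (simp add: l_def)
    have bk: "norm (z - k) \<le> 1 - norm k" if "norm z = 1" for z
    proof -
      have "z - k = N$1$1 * (M *v l z)$1 + N$1$2 * (M *v l z)$2"
        using row[of z] by (simp add: algebra_simps)
      then have "norm (z - k) \<le> norm (N$1$1) * norm ((M *v l z)$1) + norm (N$1$2) * norm ((M *v l z)$2)"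
        by (metis norm_mult norm_triangle_ineq)
      also have "\<dots> \<le> (1 - norm k) * norm ((M *v l z)$1) + (1 - norm k) * norm ((M *v l z)$2)"
        using r1[of 1] r1[of 2] by (intro add_mono mult_right_mono) (auto simp: nk)
      also have "\<dots> = (1 - norm k) * (norm ((M *v l z)$1) + norm ((M *v l z)$2))"
        by (simp add: distrib_left)
      also have "\<dots> \<le> (1 - norm k) * 1"
      proof (rule mult_left_mono[OF b[OF that]])
        show "0 \<le> 1 - norm k" using r1[of 1, simplified] norm_ge_zero[of "N$1$1"] nk by linarith
      qed
      finally show ?thesis by simp
    qed
    \<comment> \<open>The values \<open>z - k\<close> fill a unit circle around \<open>- k\<close>, but lie in the disc of radius \<open>1 - \<bar>k\<bar>\<close>
      around \<open>0\<close>; hence \<open>k = 0\<close>.\<close>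
    have "norm k \<le> 0"
    proof -
      have "(1 - k) - (- 1 - k) = 2" by simp
      then have "2 \<le> norm (1 - k) + norm (- 1 - k)"
        using norm_triangle_ineq4[of "1 - k" "- 1 - k"] by (simp only: norm_numeral)
      moreover have "norm (1 - k) \<le> 1 - norm k" "norm (- 1 - k) \<le> 1 - norm k"
        by (rule bk, simp)+
      ultimately show ?thesis by linarith
    qed
    then have k0: "k = 0" by simp
    have real: "Im (d 1 1 * (cnj z * (M *v l z)$1)) = 0 \<and> Im (d 1 2 * (cnj z * (M *v l z)$2)) = 0"
      if z: "norm z = 1" for z
    proof -
      have "cnj z * z = 1" using z complex_norm_square[of z] by (simp add: mult.commute)
      moreover have "cnj z * (N$1$1 * (M *v l z)$1 + N$1$2 * (M *v l z)$2) = cnj z * z"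
        using row[of z] k0 by simp
      ultimately have sum: "N$1$1 * (cnj z * (M *v l z)$1) + N$1$2 * (cnj z * (M *v l z)$2) + 0 = 1"
        by (simp add: algebra_simps)
      then have sum': "N$1$2 * (cnj z * (M *v l z)$2) + N$1$1 * (cnj z * (M *v l z)$1) + 0 = 1"
        by (simp only: add.commute)
      have n: "norm (N$1$1) \<le> 1" "norm (N$1$2) \<le> 1"
        using r1[of 1, simplified] r1[of 2, simplified] norm_ge_zero[of "N$1$3"] by linarith+
      have b1: "norm (cnj z * (M *v l z)$1) + norm (cnj z * (M *v l z)$2) \<le> 1"
        "norm (cnj z * (M *v l z)$2) + norm (cnj z * (M *v l z)$1) \<le> 1"
        using b[OF z] z by (simp_all add: norm_mult add.commute)
      show ?thesis
        unfolding d_def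
        using weighted_sum_one_imp_real[OF sum n _ b1(1)] weighted_sum_one_imp_real[OF sum' n(2) n(1) _ b1(2)]
        by simp
    qed
    have "d 1 j * M$j$2 = 0" if j: "j = 1 \<or> j = 2" for j
    proof -
      have "Im (cnj z * (d 1 j * M$j$1 * z - d 1 j * M$j$2 * (t * cnj z) + d 1 j * M$j$3)) = 0"
        if "norm z = 1" for z
        using real[OF that] j by (auto simp: Mv l_def algebra_simps)
      from real_after_rotation_imp_zero[OF t(1) this] show ?thesis .
    qed
    then have "M$1$2 = 0" "M$2$2 = 0" using d by auto
    then show False using NMe[of 3 2] NMe[of 2 2] nz by auto
  qed
qed

section \<open>Automorphisms of the tetrablock\<close>

lemma holomorphic_map_on_matrix:
  assumes "holomorphic_map_on f S" "x \<in> S"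
  obtains A where "(f has_derivative (*v) A) (at x within S)"
proof -
  obtain f' where f': "(f has_derivative f') (at x within S)" "Vector_Spaces.linear (*s) (*s) f'"
    using assms unfolding holomorphic_map_on_def by blast
  have "f' = (*v) (matrix f')" using matrix_works[OF f'(2)] by (simp add: fun_eq_iff)
  then show thesis using f'(1) that by metis
qed

lemma \<Psi>_compose_disc_valued:
  assumes f: "holomorphic_map_on f tetrablock" "f ` tetrablock \<subseteq> tetrablock"
    and ij: "i = 1 \<and> j = 2 \<or> i = 2 \<and> j = 1" and \<omega>: "norm \<omega> = 1" and x: "x \<in> tetrablock"
  shows "norm (\<Psi> i j \<omega> (f x)) < 1"
    and "\<exists>a. has_gradient (\<lambda>x. \<Psi> i j \<omega> (f x)) a x tetrablock"
proof -
  have fx: "f x \<in> tetrablock" using f(2) x by blast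
  show "norm (\<Psi> i j \<omega> (f x)) < 1" by (rule \<Psi>_on_tetrablock[OF fx ij \<omega>])
  obtain A where A: "(f has_derivative (*v) A) (at x within tetrablock)"
    using holomorphic_map_on_matrix[OF f(1) x] .
  show "\<exists>a. has_gradient (\<lambda>x. \<Psi> i j \<omega> (f x)) a x tetrablock"
    using has_gradient_compose[OF A f(2) has_gradient_\<Psi>[OF \<Psi>_on_tetrablock(1)[OF fx ij \<omega>] ij]]
    by blast
qed

lemma automorphism_derivative_inverse:
  assumes f: "f \<in> automorphisms \<Omega>" and x: "x \<in> interior \<Omega>"
    and A: "(f has_derivative (*v) A) (at x within \<Omega>)"
    and B: "(inv_into \<Omega> f has_derivative (*v) B) (at (f x) within \<Omega>)"
  shows "A ** B = mat 1"
proof -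
  have bij: "bij_betw f \<Omega> \<Omega>" using f by (simp add: automorphisms_def)
  then have im: "f ` \<Omega> = \<Omega>" and inj: "inj_on f \<Omega>" by (auto simp: bij_betw_def)
  have at: "at x within \<Omega> = at x" using x by (rule at_within_interior)
  have "(inv_into \<Omega> f \<circ> f has_derivative (*v) B \<circ> (*v) A) (at x within \<Omega>)"
    using diff_chain_within[OF A] B im by simp
  then have "((\<lambda>y. y) has_derivative (*v) B \<circ> (*v) A) (at x within \<Omega>)"
    using x interior_subset by (rule_tac has_derivative_transform) (auto simp: inj)
  then have "(*v) B \<circ> (*v) A = (\<lambda>y. y)"
    using has_derivative_unique has_derivative_ident unfolding at by blast
  then have "(B ** A) *v y = mat 1 *v y" for y
    by (metis comp_apply matrix_vector_mul_assoc matrix_vector_mul_lid)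
  then have "B ** A = mat 1" by (simp add: matrix_eq)
  then show ?thesis by (simp add: matrix_left_right_inverse)
qed

text \<open>
  The derivatives of the automorphism and of its inverse carry gradients of disc-valued functions to
  gradients of disc-valued functions. Applied to the functions \<open>\<Psi>\<close>, this yields a pair of inverse
  matrices of the kind excluded by \<open>no_linear_matching_of_gradients\<close>.
\<close>
theorem no_automorphism_origin_to_axis_point:
  fixes t :: real
  assumes t: "0 < t" "t < 1" and f: "f \<in> automorphisms tetrablock"
  shows "f 0 \<noteq> vector [0, 0, t]"
proof
  define p where "p = (vector [0, 0, t] :: complex^3)"
  define q where "q = 1 - t\<^sup>2"
  define h where "h = inv_into tetrablock f"
  assume "f 0 = vector [0, 0, t]"
  then have fp: "f 0 = p" by (simp add: p_def)
  have q: "0 < q" using t by (simp add: q_def abs_square_less_1)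
  have p: "p \<in> tetrablock" unfolding p_def using t by (intro slice_in_tetrablock) auto
  have zero: "0 \<in> interior tetrablock"
    using ball_subset_tetrablock by (auto simp: mem_interior intro!: exI[of _ "1/3"])
  then have zero': "0 \<in> tetrablock" using interior_subset by blast
  have hol: "holomorphic_map_on f tetrablock" "holomorphic_map_on h tetrablock"
    and bij: "bij_betw f tetrablock tetrablock"
    using f by (auto simp: automorphisms_def h_def)
  then have im: "f ` tetrablock \<subseteq> tetrablock" "h ` tetrablock \<subseteq> tetrablock"
    using bij_betw_inv_into[OF bij] by (auto simp: bij_betw_def h_def)
  have hp: "h p = 0" unfolding h_def fp[symmetric]
    using bij zero' by (simp add: bij_betw_def)
  obtain A where A: "(f has_derivative (*v) A) (at 0 within tetrablock)"
    using holomorphic_map_on_matrix[OF hol(1) zero'] .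
  obtain B where B: "(h has_derivative (*v) B) (at p within tetrablock)"
    using holomorphic_map_on_matrix[OF hol(2) p] .
  have AB: "A ** B = mat 1"
    using automorphism_derivative_inverse[OF f zero A] B by (simp add: h_def fp)
  define M where "M = (\<chi> k l. A$l$k / q)"
  define N where "N = (\<chi> k l. q * B$l$k)"
  show False
  proof (rule no_linear_matching_of_gradients[OF _ t])
    have "(N ** M)$k$l = (A ** B)$l$k" for k l
      using q by (simp add: N_def M_def matrix_matrix_mult_def sum_3 field_simps)
    then show "N ** M = mat 1" by (simp add: AB vec_eq_iff mat_def eq_commute)
  next
    fix j :: 3 and \<beta> :: complex assume j: "j \<in> {1,2}" and \<beta>: "norm \<beta> = 1"
    define j' :: 3 where "j' = (if j = 1 then 2 else 1)"
    have jj: "j = 1 \<and> j' = 2 \<or> j = 2 \<and> j' = 1" using j by (auto simp: j'_def)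
    define g where "g x = \<Psi> j j' (- \<beta>) (h x)" for x
    define b where "b = transpose B *v (\<chi> k. if k = j then 1 else if k = j' then 0 else \<beta>)"
    have "has_gradient (\<Psi> j j' (- \<beta>)) (\<chi> k. if k = j then 1 else if k = j' then 0 else \<beta>) (h p) tetrablock"
      using has_gradient_\<Psi>[OF _ jj, of "- \<beta>" 0 tetrablock] by (simp add: hp cong: if_cong)
    from has_gradient_compose[OF B im(2) this] have b: "has_gradient g b p tetrablock"
      by (simp add: g_def[abs_def] b_def)
    have g: "norm (g x) < 1" "\<exists>a. has_gradient g a x tetrablock" if "x \<in> tetrablock" for x
      using \<Psi>_compose_disc_valued[OF hol(2) im(2) jj _ that, of "- \<beta>"] \<beta> by (simp_all add: g_def[abs_def])
    have one: "1 = 1 - (norm (g p))\<^sup>2" by (simp add: g_def hp \<Psi>_def)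
    have Nb: "N$k$j + N$k$3 * \<beta> = q * b$k" for k
      using jj by (auto simp: N_def b_def matrix_vector_mult_def transpose_def sum_3 algebra_simps)
    have nN: "norm (N$k$j + N$k$3 * \<beta>) = q * norm (b$k)" for k
      unfolding Nb using q by (simp add: norm_mult)
    note bound = tetrablock_gradient_bound_at_axis_point[OF t g b[unfolded p_def] one[unfolded p_def],
        folded q_def]
    show "norm (N$3$j + N$3$3 * \<beta>) \<le> 1" unfolding nN by (rule bound(1))
    show "norm (N$1$j + N$1$3 * \<beta>) \<le> 1" if "norm (N$3$j + N$3$3 * \<beta>) = 1"
      using bound(2)[OF _ _ that[unfolded nN]] unfolding nN by blast
  next
    fix z :: complex and \<xi> :: "complex^3"
    assume z: "norm z = 1"
      and \<xi>: "\<xi> \<in> {vector [z, - (t * cnj z), 1], vector [- (t * cnj z), z, 1]}"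
    obtain i j :: 3 where ij: "i = 1 \<and> j = 2 \<or> i = 2 \<and> j = 1"
      and \<xi>ij: "\<xi>$i = z" "\<xi>$j = - (t * cnj z)" "\<xi>$3 = 1"
    proof (cases "\<xi> = vector [z, - (t * cnj z), 1]")
      case True
      then show thesis using that[of 1 2] by simp
    next
      case False
      then show thesis using that[of 2 1] \<xi> by simp
    qed
    have zz: "z * cnj z = 1" using z complex_norm_square[of z] by simp
    \<comment> \<open>With this \<open>\<omega>\<close>, the vector \<open>\<xi>\<close> is \<open>z\<close> times the gradient of \<open>\<Psi>\<close> at \<open>p\<close>.\<close>
    define \<omega> where "\<omega> = - cnj z"
    have \<omega>: "norm \<omega> = 1" using z by (simp add: \<omega>_def)
    define c where "c = (\<chi> k. if k = i then 1 else if k = j then - (\<omega>\<^sup>2 * t) else - \<omega>)"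
    have z\<xi>: "\<xi> = z *s c"
    proof -
      have "\<xi>$k = z * c$k" for k
        using exhaust_3[of k] ij \<xi>ij zz
        by (auto simp: c_def \<omega>_def power2_eq_square algebra_simps)
      then show ?thesis by (simp add: vec_eq_iff)
    qed
    define g where "g x = \<Psi> i j \<omega> (f x)" for x
    have "has_gradient (\<Psi> i j \<omega>) c (f 0) tetrablock"
    proof -
      have pk: "p$i = 0" "p$j = 0" "p$3 = t" using ij by (auto simp: p_def)
      show ?thesis
        using has_gradient_\<Psi>[OF _ ij, of \<omega> p tetrablock]
        by (simp add: fp pk c_def power2_eq_square mult.assoc cong: if_cong)
    qed
    from has_gradient_compose[OF A im(1) this]
    have b: "has_gradient g (transpose A *v c) 0 tetrablock" by (simp add: g_def[abs_def])
    have g: "norm (g x) < 1" "\<exists>a. has_gradient g a x tetrablock" if "x \<in> tetrablock" for x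
      using \<Psi>_compose_disc_valued[OF hol(1) im(1) ij \<omega> that] by (simp_all add: g_def[abs_def])
    have q': "1 - (norm (g 0))\<^sup>2 = q"
      using ij \<omega> t by (auto simp: g_def fp p_def \<Psi>_def q_def norm_mult)
    have "(M *v \<xi>)$k = z * (transpose A *v c)$k / q" for k
      by (simp add: z\<xi> M_def matrix_vector_mult_def transpose_def sum_3 algebra_simps add_divide_distrib)
    then have nM: "norm ((M *v \<xi>)$k) = norm ((transpose A *v c)$k) / q" for k
      using q z by (simp add: norm_divide norm_mult)
    show "norm ((M *v \<xi>)$1) + norm ((M *v \<xi>)$2) \<le> 1 \<and> norm ((M *v \<xi>)$3) \<le> 1"
      using tetrablock_gradient_bound_at_zero[OF g b] q unfolding nM q'
      by (simp add: field_simps)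
  qed
qed

theorem corollary3p2:
  shows "\<not> homogeneous tetrablock"
proof
  assume "homogeneous tetrablock"
  moreover have "0 \<in> tetrablock" "(vector [0, 0, of_real (1/2)] :: complex^3) \<in> tetrablock"
    by (intro slice_in_tetrablock; simp add: norm_divide)+
  ultimately obtain f where "f \<in> automorphisms tetrablock" "f 0 = vector [0, 0, of_real (1/2)]"
    unfolding homogeneous_def by blast
  then show False using no_automorphism_origin_to_axis_point[of "1/2" f] by simp
qed

end
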